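(* Let $f:[0,\infty)\to[0,\infty)$, $K>0$, $M\ge1$ and $c$ satisfy Assumptions A and B (stated in the context), and let $\mu_1,\mu_2$ be the numbers defined in the context. For any $\alpha_n\in[0,1]$, the map $F_{\alpha_n}(x)=\alpha_n x+(1-\alpha_n)f(x)$ satisfies $$F_{\alpha_n}\left([\mu_1,\mu_2]\right)\subseteq[\mu_1,\mu_2].$$
   Context: Assumption A: $f:[0,\infty)\to[0,\infty)$ is a continuous function, $f(x)>0$ for $x>0$, $f(x)>x$ for $x\in(0,K)$, $f(x)<x$ for $x>K$, and $M\ge1$ is a constant such that $|f(x)-K|\le M|x-K|$ for all $x\ge 0$. (Hence $K>0$ is the unique positive fixed point of $f$.) Assumption B: there is a point $c\in[0,K)$ such that $f$ is strictly decreasing on $[c,\infty)$. (Consequently the maximum of $f$ on $[0,\infty)$ is attained on $[0,c]$.) Definition of $\mu_0,\mu_1,\mu_2$: $\mu_0:=\inf\{x\in[0,c]: f(x)=\max_{s\in[0,\infty)}f(s)\}$ is the smallest point where the maximum of $f$ is attained; $\mu_2:=f(\mu_0)$ is the value of this maximum; $\mu_1:=f(\mu_2)$. One has $\mu_1<K<\mu_2$. *)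

theory Defs
  imports "HOL-Analysis.Analysis"
begin

text \<open>
  A map from \<open>[0,\<infinity>)\<close> to itself is represented by a function on all reals of which only
  the restriction to \<open>{0..}\<close> matters.
\<close>

definition assumption_A :: "(real \<Rightarrow> real) \<Rightarrow> real \<Rightarrow> real \<Rightarrow> bool" where
  "assumption_A f K M \<longleftrightarrow>
     f \<in> {0..} \<rightarrow> {0..} \<and> continuous_on {0..} f \<and>
     (\<forall>x>0. f x > 0) \<and>
     0 < K \<and> (\<forall>x\<in>{0<..<K}. f x > x) \<and> (\<forall>x>K. f x < x) \<and>
     1 \<le> M \<and> (\<forall>x\<ge>0. \<bar>f x - K\<bar> \<le> M * \<bar>x - K\<bar>)"

definition assumption_B :: "(real \<Rightarrow> real) \<Rightarrow> real \<Rightarrow> real \<Rightarrow> bool" where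
  "assumption_B f K c \<longleftrightarrow> c \<in> {0..<K} \<and> strict_antimono_on {c..} f"

text \<open>The library's \<^const>\<open>Max\<close> is for finite sets only, hence \<^const>\<open>Greatest\<close>.\<close>

definition max_value :: "(real \<Rightarrow> real) \<Rightarrow> real" where
  "max_value f = (GREATEST y. y \<in> f ` {0..})"

definition mu0 :: "(real \<Rightarrow> real) \<Rightarrow> real \<Rightarrow> real" where
  "mu0 f c = Inf {x \<in> {0..c}. f x = max_value f}"

definition mu2 :: "(real \<Rightarrow> real) \<Rightarrow> real \<Rightarrow> real" where
  "mu2 f c = f (mu0 f c)"

definition mu1 :: "(real \<Rightarrow> real) \<Rightarrow> real \<Rightarrow> real" where
  "mu1 f c = f (mu2 f c)"

definition F :: "(real \<Rightarrow> real) \<Rightarrow> real \<Rightarrow> real \<Rightarrow> real" where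
  "F f \<alpha> x = \<alpha> * x + (1 - \<alpha>) * f x"

end

theory Submission
  imports Defs
begin

text \<open>
  Since \<^term>\<open>F f \<alpha> x\<close> is a convex combination of \<^term>\<open>x\<close> and \<^term>\<open>f x\<close>, and an interval is
  convex, it is enough that \<^term>\<open>f\<close> itself maps the interval into itself. The right end
  \<open>\<mu>\<^sub>2\<close> is the global maximum of \<^term>\<open>f\<close>, so only the bound \<open>\<mu>\<^sub>1 \<le> f x\<close> needs an argument.
  To the right of \<^term>\<open>c\<close> the map decreases, so \<open>x \<le> \<mu>\<^sub>2\<close> yields \<open>f x \<ge> f \<mu>\<^sub>2 = \<mu>\<^sub>1\<close>. To the left
  of \<^term>\<open>c\<close>, hence of the fixed point \<^term>\<open>K\<close>, the graph lies above the diagonal on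
  positive arguments, and \<open>x \<ge> \<mu>\<^sub>1 > 0\<close>, so \<open>f x > x \<ge> \<mu>\<^sub>1\<close>. The rest is the fact that \<open>\<mu>\<^sub>2\<close>, defined through a greatest value and an
  infimum, really is the maximum, which is a matter of compactness.
\<close>

text \<open>
  Beyond \<^term>\<open>c\<close> the values stay below \<^term>\<open>f c\<close>, so the maximum over the compact interval
  from \<^term>\<open>0\<close> to \<^term>\<open>c\<close> is global.
\<close>

lemma maximum_attained_before_decrease:
  fixes f :: "real \<Rightarrow> real"
  assumes "continuous_on {0..} f" and "0 \<le> c" and "strict_antimono_on {c..} f"
  obtains m where "m \<in> {0..c}" and "\<And>x. x \<ge> 0 \<Longrightarrow> f x \<le> f m"
proof -
  have "continuous_on {0..c} f"
    by (rule continuous_on_subset[OF assms(1)]) auto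
  then obtain m where m: "m \<in> {0..c}" "\<And>x. x \<in> {0..c} \<Longrightarrow> f x \<le> f m"
    using continuous_attains_sup[of "{0..c}" f] \<open>0 \<le> c\<close> by auto
  have "f x \<le> f m" if "x \<ge> 0" for x
  proof (cases "x \<le> c")
    case True
    then show ?thesis using m(2) that by simp
  next
    case False
    then have "f x < f c"
      using monotone_onD[OF assms(3), of c x] by simp
    also have "f c \<le> f m" using m(2) \<open>0 \<le> c\<close> by simp
    finally show ?thesis by simp
  qed
  then show thesis using m(1) that by blast
qed

text \<open>
  The set of maximisers in the compact interval is closed and nonempty, so it contains its
  infimum; hence \<^term>\<open>mu0 f c\<close> is itself a maximiser.
\<close>

lemma le_mu2:
  fixes f :: "real \<Rightarrow> real"
  assumes cont: "continuous_on {0..} f" and "0 \<le> c" and "strict_antimono_on {c..} f"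
    and "x \<ge> 0"
  shows "f x \<le> mu2 f c"
proof -
  obtain m where m: "m \<in> {0..c}" and max: "\<And>x. x \<ge> 0 \<Longrightarrow> f x \<le> f m"
    using maximum_attained_before_decrease[OF assms(1-3)] by metis
  have max_eq: "max_value f = f m"
    unfolding max_value_def by (rule Greatest_equality) (use m max in auto)
  let ?S = "{x \<in> {0..c}. f x = max_value f}"
  have "continuous_on {0..c} f"
    by (rule continuous_on_subset[OF cont]) auto
  then have "closed ?S"
    by (rule continuous_closed_preimage_constant) simp
  moreover have "m \<in> ?S" using m max_eq by simp
  moreover have "bdd_below ?S" by (rule bdd_belowI[of _ 0]) simp
  ultimately have "mu0 f c \<in> ?S"
    unfolding mu0_def by (intro closed_contains_Inf) auto
  then show ?thesis using max[OF \<open>x \<ge> 0\<close>] max_eq by (simp add: mu2_def)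
qed

lemma mu_interval_invariant:
  assumes A: "assumption_A f K M" and B: "assumption_B f K c"
    and x: "x \<in> {mu1 f c..mu2 f c}"
  shows "f x \<in> {mu1 f c..mu2 f c}"
proof -
  from A have cont: "continuous_on {0..} f" and pos: "\<And>x. x > 0 \<Longrightarrow> f x > 0" and "0 < K"
    and above: "\<And>x. 0 < x \<Longrightarrow> x < K \<Longrightarrow> f x > x"
    and lip: "\<And>x. x \<ge> 0 \<Longrightarrow> \<bar>f x - K\<bar> \<le> M * \<bar>x - K\<bar>"
    unfolding assumption_A_def by auto
  from B have c: "0 \<le> c" "c < K" and decr: "strict_antimono_on {c..} f"
    unfolding assumption_B_def by auto
  note le_max = le_mu2[OF cont c(1) decr]
  have "f K = K" using lip[of K] \<open>0 < K\<close> by simp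
  then have "K \<le> mu2 f c" using le_max[of K] \<open>0 < K\<close> by simp
  \<comment> \<open>Strict positivity matters: at \<open>0\<close> the graph need not lie above the diagonal.\<close>
  then have "mu1 f c > 0" using pos \<open>0 < K\<close> by (simp add: mu1_def)
  then have "x > 0" using x by simp
  have "mu1 f c \<le> f x"
  proof (cases "x < c")
    case True
    then show ?thesis using above[of x] \<open>x > 0\<close> c x by simp
  next
    case False
    then show ?thesis
      using monotone_onD[OF decr, of x "mu2 f c"] x
      by (cases "x = mu2 f c") (auto simp: mu1_def)
  qed
  then show ?thesis using le_max \<open>x > 0\<close> by simp
qed

theorem lemma2p5:
  fixes f :: "real \<Rightarrow> real" and K M c \<alpha> :: real
  assumes "assumption_A f K M"
    and "assumption_B f K c"
    and "\<alpha> \<in> {0..1}"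
  shows "F f \<alpha> ` {mu1 f c..mu2 f c} \<subseteq> {mu1 f c..mu2 f c}"
proof
  fix y assume "y \<in> F f \<alpha> ` {mu1 f c..mu2 f c}"
  then obtain x where x: "x \<in> {mu1 f c..mu2 f c}" and y: "y = F f \<alpha> x" by blast
  have "\<alpha> *\<^sub>R x + (1 - \<alpha>) *\<^sub>R f x \<in> {mu1 f c..mu2 f c}"
    using x mu_interval_invariant[OF assms(1,2) x] assms(3)
    by (intro convexD convex_real_interval) auto
  then show "y \<in> {mu1 f c..mu2 f c}" by (simp add: y F_def)
qed

end
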